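(* Let $G$ be a graph and $k\ge 0$ an integer. If a layout $\pi$ of $G$ has active neighborhood-width $\mathrm{anw}_\pi(G)\le k$, then there is a play of width at most $2k+2$ that constructs $G$ and in which every birth introduces a single vertex.
   Context: All graphs are finite, simple and undirected. Active neighborhood-width of a layout. A layout of $G$ is a linear order $\pi=(v_1,\dots,v_n)$ of $V(G)$; put $P_i=\{v_1,\dots,v_i\}$ for $0\le i\le n$. For $u\in P_i$ let $r_i^\pi(u)=N_G(u)\cap (V(G)\setminus P_i)$. Let $\mathcal A_i^\pi=\{r_i^\pi(u):u\in P_i\}\setminus\{\emptyset\}$. Then $\mathrm{anw}_\pi(G)=\max_i|\mathcal A_i^\pi|$. Sequential cable plays. A configuration on $G$ consists of the set of born vertices, a family $\mathcal L$ of pairwise disjoint nonempty sets of born vertices (the live cables), and a set of already placed edges; initially all are empty. With $\ell=|\mathcal L|$ the number of live cables before a move, the moves are: (i) birth$(S)$: introduces a nonempty set $S$ of fresh (not yet born) vertices of $G$ as one live cable; cost $2\ell+1$. (ii) fold$(X,Y)$: replaces two distinct live cables $X,Y$ by $X\cup Y$; cost $2\ell-1$. (iii) block$(X,Y)$: places every edge between two distinct live cables $X,Y$; legal when all these pairs are edges of $G$ and at least one has not already been placed; cost $2\ell$. (iv) clique$(X)$: places every edge inside a live cable $X$; legal when $X$ is a clique of $G$ and at least one internal edge has not already been placed; cost $2\ell$. (v) close$(X)$: removes the live cable $X$; legal when every edge of $G$ incident with a vertex of $X$ has already been placed; cost $2\ell-1$. A play (a finite sequence of legal moves from the initial configuration)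 constructs $G$ if every vertex is born, every edge of $G$ is placed, and every cable is closed. The width of a play is the maximum cost of its moves (and $0$ for the empty play on the empty graph). *)

theory Defs
  imports Main
begin

definition simple_graph :: "'a set \<Rightarrow> 'a set set \<Rightarrow> bool" where
  "simple_graph V E \<longleftrightarrow> finite V \<and> (\<forall>e\<in>E. e \<subseteq> V \<and> card e = 2)"

definition neighbors :: "'a set set \<Rightarrow> 'a \<Rightarrow> 'a set" where
  "neighbors E u = {w. {u, w} \<in> E}"

definition layout :: "'a set \<Rightarrow> 'a list \<Rightarrow> bool" where
  "layout V p \<longleftrightarrow> distinct p \<and> set p = V"

definition layout_prefix :: "'a list \<Rightarrow> nat \<Rightarrow> 'a set" where
  "layout_prefix p i = set (take i p)"

definition right_nbhd :: "'a set \<Rightarrow> 'a set set \<Rightarrow> 'a list \<Rightarrow> nat \<Rightarrow> 'a \<Rightarrow> 'a set" where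
  "right_nbhd V E p i u = neighbors E u \<inter> (V - layout_prefix p i)"

definition active_nbhds :: "'a set \<Rightarrow> 'a set set \<Rightarrow> 'a list \<Rightarrow> nat \<Rightarrow> 'a set set" where
  "active_nbhds V E p i = right_nbhd V E p i ` layout_prefix p i - {{}}"

definition anw :: "'a set \<Rightarrow> 'a set set \<Rightarrow> 'a list \<Rightarrow> nat" where
  "anw V E p = Max ((\<lambda>i. card (active_nbhds V E p i)) ` {0..length p})"

record 'a config =
  born :: "'a set"
  live :: "'a set set"
  placed :: "'a set set"

definition init_config :: "'a config" where
  "init_config = \<lparr>born = {}, live = {}, placed = {}\<rparr>"

datatype 'a move =
    Birth "'a set"
  | Fold "'a set" "'a set"
  | Block "'a set" "'a set"
  | Clique "'a set"
  | Close "'a set"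

definition pairs_between :: "'a set \<Rightarrow> 'a set \<Rightarrow> 'a set set" where
  "pairs_between X Y = {{x, y} | x y. x \<in> X \<and> y \<in> Y}"

definition pairs_inside :: "'a set \<Rightarrow> 'a set set" where
  "pairs_inside X = {{x, y} | x y. x \<in> X \<and> y \<in> X \<and> x \<noteq> y}"

text \<open>Legality refers to edges through set inclusions: \<open>pairs_inside X \<subseteq> E\<close> says that \<open>X\<close> is a
  clique, and \<open>\<not> pairs_inside X \<subseteq> placed c\<close> that some internal edge is still missing (so in
  particular \<open>X\<close> has at least two vertices).\<close>

fun legal :: "'a set \<Rightarrow> 'a set set \<Rightarrow> 'a config \<Rightarrow> 'a move \<Rightarrow> bool" where
  "legal V E c (Birth S) \<longleftrightarrow> S \<noteq> {} \<and> S \<subseteq> V \<and> S \<inter> born c = {}"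
| "legal V E c (Fold X Y) \<longleftrightarrow> X \<in> live c \<and> Y \<in> live c \<and> X \<noteq> Y"
| "legal V E c (Block X Y) \<longleftrightarrow> X \<in> live c \<and> Y \<in> live c \<and> X \<noteq> Y \<and>
     pairs_between X Y \<subseteq> E \<and> \<not> pairs_between X Y \<subseteq> placed c"
| "legal V E c (Clique X) \<longleftrightarrow> X \<in> live c \<and>
     pairs_inside X \<subseteq> E \<and> \<not> pairs_inside X \<subseteq> placed c"
| "legal V E c (Close X) \<longleftrightarrow> X \<in> live c \<and> (\<forall>e\<in>E. e \<inter> X \<noteq> {} \<longrightarrow> e \<in> placed c)"

fun apply_move :: "'a config \<Rightarrow> 'a move \<Rightarrow> 'a config" where
  "apply_move c (Birth S) = c\<lparr>born := born c \<union> S, live := insert S (live c)\<rparr>"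
| "apply_move c (Fold X Y) = c\<lparr>live := insert (X \<union> Y) (live c - {X, Y})\<rparr>"
| "apply_move c (Block X Y) = c\<lparr>placed := placed c \<union> pairs_between X Y\<rparr>"
| "apply_move c (Clique X) = c\<lparr>placed := placed c \<union> pairs_inside X\<rparr>"
| "apply_move c (Close X) = c\<lparr>live := live c - {X}\<rparr>"

text \<open>The truncated subtraction is harmless: a legal fold or close needs a live cable, and the
  set of live cables stays finite along every play on a finite graph.\<close>

fun cost :: "'a config \<Rightarrow> 'a move \<Rightarrow> nat" where
  "cost c (Birth S) = 2 * card (live c) + 1"
| "cost c (Fold X Y) = 2 * card (live c) - 1"
| "cost c (Block X Y) = 2 * card (live c)"
| "cost c (Clique X) = 2 * card (live c)"
| "cost c (Close X) = 2 * card (live c) - 1"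

fun legal_from :: "'a set \<Rightarrow> 'a set set \<Rightarrow> 'a config \<Rightarrow> 'a move list \<Rightarrow> bool" where
  "legal_from V E c [] \<longleftrightarrow> True"
| "legal_from V E c (m # ms) \<longleftrightarrow> legal V E c m \<and> legal_from V E (apply_move c m) ms"

fun width_from :: "'a config \<Rightarrow> 'a move list \<Rightarrow> nat" where
  "width_from c [] = 0"
| "width_from c (m # ms) = max (cost c m) (width_from (apply_move c m) ms)"

definition is_play :: "'a set \<Rightarrow> 'a set set \<Rightarrow> 'a move list \<Rightarrow> bool" where
  "is_play V E ms \<longleftrightarrow> legal_from V E init_config ms"

definition play_width :: "'a move list \<Rightarrow> nat" where
  "play_width ms = width_from init_config ms"

definition final_config :: "'a move list \<Rightarrow> 'a config" where
  "final_config ms = foldl apply_move init_config ms"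

definition constructs :: "'a set \<Rightarrow> 'a set set \<Rightarrow> 'a move list \<Rightarrow> bool" where
  "constructs V E ms \<longleftrightarrow>
     V \<subseteq> born (final_config ms) \<and> E \<subseteq> placed (final_config ms) \<and> live (final_config ms) = {}"

text \<open>The remaining requirements on a configuration (cables are pairwise disjoint nonempty sets of
  born vertices, and only edges of the graph are placed) are not part of the record type; they hold
  initially and are preserved by legal moves.\<close>

definition valid_config :: "'a set \<Rightarrow> 'a set set \<Rightarrow> 'a config \<Rightarrow> bool" where
  "valid_config V E c \<longleftrightarrow> born c \<subseteq> V \<and> placed c \<subseteq> E \<and>
     (\<forall>X\<in>live c. X \<noteq> {} \<and> X \<subseteq> born c) \<and>
     (\<forall>X\<in>live c. \<forall>Y\<in>live c. X \<noteq> Y \<longrightarrow> X \<inter> Y = {})"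

lemma valid_init_config: "valid_config V E init_config"
  by (simp add: valid_config_def init_config_def)

lemma valid_apply_move:
  assumes "valid_config V E c" and "legal V E c m"
  shows "valid_config V E (apply_move c m)"
proof (cases m)
  case (Birth S)
  then show ?thesis using assms by (simp add: valid_config_def) blast
next
  case (Fold X Y)
  then show ?thesis using assms by (simp add: valid_config_def) blast
qed (use assms in \<open>auto simp: valid_config_def\<close>)

end

theory Submission
  imports Defs
begin

text \<open>Sweep along the layout, keeping one live cable for each nonempty right neighbourhood of a
  vertex of the current prefix; so at most \<open>k\<close> cables are live between two rounds.
  To add the next vertex \<open>v\<close>, give birth to \<open>{v}\<close> (cost at most \<open>2k + 1\<close>) and block it with every
  cable whose right neighbourhood contains \<open>v\<close> (cost at most \<open>2k + 2\<close>); this places all edges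
  from \<open>v\<close> to the prefix. Right neighbourhoods now only lose \<open>v\<close>, so each cable still has a common
  one, and closing the exhausted cables and folding those that have become equal (cost at most
  \<open>2k + 1\<close>) restores the invariant.\<close>

section \<open>Plays as reachability between configurations\<close>

definition cheap_step :: "'a set \<Rightarrow> 'a set set \<Rightarrow> nat \<Rightarrow> 'a config \<Rightarrow> 'a config \<Rightarrow> bool" where
  "cheap_step V E w c c' \<longleftrightarrow> (\<exists>m. legal V E c m \<and> cost c m \<le> w \<and>
     (\<forall>S. m = Birth S \<longrightarrow> (\<exists>v. S = {v})) \<and> c' = apply_move c m)"

text \<open>Transitivity of this relation glues the phases of the sweep together; an explicit list
  of moves is extracted only once, at the very end.\<close>

abbreviation reach :: "'a set \<Rightarrow> 'a set set \<Rightarrow> nat \<Rightarrow> 'a config \<Rightarrow> 'a config \<Rightarrow> bool" where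
  "reach V E w \<equiv> (cheap_step V E w)\<^sup>*\<^sup>*"

lemma cheap_stepI:
  assumes "legal V E c m" and "cost c m \<le> w" and "\<And>S. m = Birth S \<Longrightarrow> \<exists>v. S = {v}"
  shows "cheap_step V E w c (apply_move c m)"
  using assms unfolding cheap_step_def by blast

lemma reach_imp_moves:
  assumes "reach V E w c c'"
  shows "\<exists>ms. legal_from V E c ms \<and> width_from c ms \<le> w \<and>
    (\<forall>S. Birth S \<in> set ms \<longrightarrow> (\<exists>v. S = {v})) \<and> foldl apply_move c ms = c'"
  using assms
proof (induction rule: converse_rtranclp_induct)
  case base
  show ?case by (rule exI[of _ "[]"]) simp
next
  case (step c d)
  from step.hyps(1) obtain m where m: "legal V E c m" "cost c m \<le> w"
    "\<forall>S. m = Birth S \<longrightarrow> (\<exists>v. S = {v})" "d = apply_move c m"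
    unfolding cheap_step_def by blast
  from step.IH obtain ms where "legal_from V E d ms" "width_from d ms \<le> w"
    "\<forall>S. Birth S \<in> set ms \<longrightarrow> (\<exists>v. S = {v})" "foldl apply_move d ms = c'" by blast
  with m show ?case by (intro exI[of _ "m # ms"]) auto
qed

text \<open>Blocks leave \<open>live c\<close> unchanged, so every one of them costs the same
  \<open>2 * card (live c)\<close> and the cables in \<open>B\<close> can be treated one after
  another.\<close>

lemma reach_blocks:
  assumes "finite B" and "B \<subseteq> live c - {X}" and "X \<in> live c"
    and "\<And>Y. Y \<in> B \<Longrightarrow> pairs_between X Y \<subseteq> E" and "2 * card (live c) \<le> w"
  shows "reach V E w c (c\<lparr>placed := placed c \<union> (\<Union>Y\<in>B. pairs_between X Y)\<rparr>)"
  using assms(1,2,4)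
proof (induction B rule: finite_induct)
  case empty
  show ?case by simp
next
  case (insert Y B)
  let ?d = "c\<lparr>placed := placed c \<union> (\<Union>Y\<in>B. pairs_between X Y)\<rparr>"
  let ?e = "c\<lparr>placed := placed c \<union> (\<Union>Y\<in>insert Y B. pairs_between X Y)\<rparr>"
  have reach_d: "reach V E w c ?d" using insert by blast
  have e: "?e = apply_move ?d (Block X Y)" by (simp add: Un_ac)
  \<comment> \<open>A block that places nothing new is illegal; it is skipped, since the target
    configuration is then already reached.\<close>
  show ?case
  proof (cases "pairs_between X Y \<subseteq> placed ?d")
    case True
    then have "placed c \<union> (\<Union>Y\<in>insert Y B. pairs_between X Y) =
        placed c \<union> (\<Union>Y\<in>B. pairs_between X Y)" by auto
    then have "?e = ?d" by (simp only:)
    then show ?thesis using reach_d by simp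
  next
    case False
    have "cheap_step V E w ?d (apply_move ?d (Block X Y))"
      by (rule cheap_stepI) (use False insert.prems assms(3,5) in auto)
    with reach_d show ?thesis unfolding e by (rule rtranclp.rtrancl_into_rtrancl)
  qed
qed

section \<open>Normalising the live cables to the fibres of a function\<close>

definition fibres :: "('a \<Rightarrow> 'b set) \<Rightarrow> 'a set \<Rightarrow> 'a set set" where
  "fibres f P = (\<lambda>S. {u \<in> P. f u = S}) ` (f ` P - {{}})"

text \<open>By \<open>hom\<close> and \<open>sep\<close>, each member of \<open>L\<close> is the
  entire fibre through any of its points; by the covering assumption every fibre with nonempty value
  arises so. The fourth assumption and \<open>sep\<close> express that no cable is left to close and
  no two are left to fold.\<close>

lemma fibres_eqI:
  assumes "{} \<notin> L" and "\<Union>L \<subseteq> P" and "\<And>u. u \<in> P \<Longrightarrow> f u \<noteq> {} \<Longrightarrow> u \<in> \<Union>L"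
    and "\<And>X u. X \<in> L \<Longrightarrow> u \<in> X \<Longrightarrow> f u \<noteq> {}"
    and hom: "\<And>X u w. X \<in> L \<Longrightarrow> u \<in> X \<Longrightarrow> w \<in> X \<Longrightarrow> f u = f w"
    and sep: "\<And>X Y u w. X \<in> L \<Longrightarrow> Y \<in> L \<Longrightarrow> u \<in> X \<Longrightarrow> w \<in> Y \<Longrightarrow> f u = f w \<Longrightarrow> X = Y"
  shows "L = fibres f P"
proof -
  have fibre: "X = {w \<in> P. f w = f u}" if "X \<in> L" "u \<in> X" for X u
  proof
    show "X \<subseteq> {w \<in> P. f w = f u}"
      using that(1) assms(2) hom[OF that(1) _ that(2)] by auto
    show "{w \<in> P. f w = f u} \<subseteq> X"
    proof
      fix w assume w: "w \<in> {w \<in> P. f w = f u}"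
      then have "f w \<noteq> {}" using assms(4)[OF that] by simp
      with w obtain Y where Y: "Y \<in> L" "w \<in> Y" using assms(3)[of w] by auto
      have "X = Y" by (rule sep[OF that(1) Y(1) that(2) Y(2)]) (use w in simp)
      with Y show "w \<in> X" by simp
    qed
  qed
  show ?thesis
  proof
    show "L \<subseteq> fibres f P"
    proof
      fix X assume X: "X \<in> L"
      then obtain u where u: "u \<in> X" using assms(1) by (metis all_not_in_conv)
      then have "u \<in> P" "f u \<noteq> {}" using X assms(2) assms(4)[OF X u] by auto
      then show "X \<in> fibres f P" unfolding fibres_def using fibre[OF X u] by blast
    qed
    show "fibres f P \<subseteq> L"
    proof
      fix X assume "X \<in> fibres f P"
      then obtain u where u: "u \<in> P" "f u \<noteq> {}" "X = {w \<in> P. f w = f u}"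
        unfolding fibres_def by blast
      then obtain Y where Y: "Y \<in> L" "u \<in> Y" using assms(3)[of u] by blast
      then show "X \<in> L" using fibre[OF Y] u(3) by simp
    qed
  qed
qed

text \<open>Strong induction on the number of live cables: each close or fold lowers it, so the cost
  bound persists, and once neither applies \<open>fibres_eqI\<close> identifies the live
  family.\<close>

lemma reach_fibres:
  assumes "finite (live c)" and "{} \<notin> live c" and "\<Union>(live c) \<subseteq> P"
    and "\<And>u. u \<in> P \<Longrightarrow> f u \<noteq> {} \<Longrightarrow> u \<in> \<Union>(live c)"
    and "\<And>X u w. X \<in> live c \<Longrightarrow> u \<in> X \<Longrightarrow> w \<in> X \<Longrightarrow> f u = f w"
    and "\<And>u e. u \<in> P \<Longrightarrow> f u = {} \<Longrightarrow> e \<in> E \<Longrightarrow> u \<in> e \<Longrightarrow> e \<in> placed c"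
    and "2 * card (live c) \<le> w"
  shows "reach V E w c (c\<lparr>live := fibres f P\<rparr>)"
  using assms
proof (induction "card (live c)" arbitrary: c rule: less_induct)
  case less
  note prems = less.prems
  \<comment> \<open>Shared end of the close and fold cases: one cheap move to a smaller family that
    keeps the hypotheses, then the induction hypothesis.\<close>
  have via: "reach V E w c (c\<lparr>live := fibres f P\<rparr>)"
    if "cheap_step V E w c (c\<lparr>live := L\<rparr>)" and "finite L" and "card L < card (live c)"
      and "{} \<notin> L" and "\<Union>L \<subseteq> P" and "\<And>u. u \<in> P \<Longrightarrow> f u \<noteq> {} \<Longrightarrow> u \<in> \<Union>L"
      and "\<And>Z u w. Z \<in> L \<Longrightarrow> u \<in> Z \<Longrightarrow> w \<in> Z \<Longrightarrow> f u = f w" for L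
  proof -
    have live: "live (c\<lparr>live := L\<rparr>) = L" by simp
    have "reach V E w (c\<lparr>live := L\<rparr>) (c\<lparr>live := L\<rparr>\<lparr>live := fibres f P\<rparr>)"
    proof (rule less.hyps)
      show "e \<in> placed (c\<lparr>live := L\<rparr>)" if "u \<in> P" "f u = {}" "e \<in> E" "u \<in> e" for u e
        using prems(6)[OF that] by simp
      show "2 * card (live (c\<lparr>live := L\<rparr>)) \<le> w" using \<open>card L < card (live c)\<close> prems(7) by simp
    qed (unfold live, (fact that)+)
    with that(1) show ?thesis by (simp add: converse_rtranclp_into_rtranclp)
  qed
  \<comment> \<open>As \<open>f\<close> is constant on each cable, a single vertex with empty value
    makes its whole cable exhausted, and a single common value makes two cables agree
    throughout.\<close>
  consider (exhausted) X where "X \<in> live c" "\<forall>u\<in>X. f u = {}"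
    | (equal) X Y where "X \<in> live c" "Y \<in> live c" "X \<noteq> Y" "\<forall>u\<in>X. \<forall>w\<in>Y. f u = f w"
    | (reduced) "\<And>X u. X \<in> live c \<Longrightarrow> u \<in> X \<Longrightarrow> f u \<noteq> {}"
        "\<And>X Y u w. X \<in> live c \<Longrightarrow> Y \<in> live c \<Longrightarrow> u \<in> X \<Longrightarrow> w \<in> Y \<Longrightarrow> f u = f w \<Longrightarrow> X = Y"
    using prems(5) by metis
  then show ?case
  proof cases
    case exhausted
    show ?thesis
    proof (rule via)
      \<comment> \<open>Such an edge contains a vertex of \<open>P\<close> with empty value, so the
        sixth hypothesis makes the close legal.\<close>
      have "e \<in> placed c" if "e \<in> E" "e \<inter> X \<noteq> {}" for e
        using that exhausted prems(3) prems(6) by blast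
      then have "cheap_step V E w c (apply_move c (Close X))"
        using exhausted(1) prems(7) by (intro cheap_stepI) auto
      then show "cheap_step V E w c (c\<lparr>live := live c - {X}\<rparr>)" by simp
      show "card (live c - {X}) < card (live c)" by (rule card_Diff1_less) fact+
      show "u \<in> \<Union>(live c - {X})" if "u \<in> P" "f u \<noteq> {}" for u
        using prems(4)[OF that] that exhausted by auto
      show "f u = f w" if "Z \<in> live c - {X}" "u \<in> Z" "w \<in> Z" for Z u w
        using prems(5) that by (meson DiffD1)
    qed (use prems(1-3) in auto)
  next
    case equal
    let ?L = "insert (X \<union> Y) (live c - {X, Y})"
    have UnL: "\<Union>?L = \<Union>(live c)" using equal(1,2) by auto
    show ?thesis
    proof (rule via)
      have "cheap_step V E w c (apply_move c (Fold X Y))"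
        using equal(1-3) prems(7) by (intro cheap_stepI) auto
      then show "cheap_step V E w c (c\<lparr>live := ?L\<rparr>)" by simp
      \<comment> \<open>A fold removes two cables and inserts at most one.\<close>
      have "card {X, Y} \<le> card (live c)" using equal(1,2) prems(1) by (intro card_mono) auto
      moreover have "card (live c - {X, Y}) = card (live c) - card {X, Y}"
        using equal(1,2) by (intro card_Diff_subset) auto
      moreover have "card ?L \<le> Suc (card (live c - {X, Y}))"
        using prems(1) by (simp add: card_insert_if)
      ultimately show "card ?L < card (live c)" using equal(3) by simp
      show "{} \<notin> ?L" using prems(2) equal(1) by auto
      show "\<Union>?L \<subseteq> P" using UnL prems(3) by simp
      show "u \<in> \<Union>?L" if "u \<in> P" "f u \<noteq> {}" for u
        using prems(4)[OF that] unfolding UnL .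
      show "f u = f w" if Z: "Z \<in> ?L" "u \<in> Z" "w \<in> Z" for Z u w
      proof (cases "Z = X \<union> Y")
        case True
        then show ?thesis using Z(2,3) equal prems(5) by (metis Un_iff)
      next
        case False
        then show ?thesis using Z prems(5) by (metis DiffD1 insertE)
      qed
    qed (use prems(1) in simp)
  next
    case reduced
    have "live c = fibres f P"
      by (rule fibres_eqI) (fact prems(2-5) reduced)+
    then have "c\<lparr>live := fibres f P\<rparr> = c" by (cases c) simp
    then show ?thesis by simp
  qed
qed

section \<open>One round of the sweep\<close>

definition out_nbhd :: "'a set \<Rightarrow> 'a set set \<Rightarrow> 'a set \<Rightarrow> 'a \<Rightarrow> 'a set" where
  "out_nbhd V E P u = neighbors E u \<inter> (V - P)"

text \<open>The state between two rounds, fixed completely so that rounds compose by transitivity.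
  Vertices of \<open>P\<close> without neighbours outside \<open>P\<close> lie in no live cable:
  they have been closed.\<close>

definition sweep_config :: "'a set \<Rightarrow> 'a set set \<Rightarrow> 'a set \<Rightarrow> 'a config" where
  "sweep_config V E P =
     \<lparr>born = P, live = fibres (out_nbhd V E P) P, placed = {e \<in> E. e \<subseteq> P}\<rparr>"

lemma simple_graph_edgeE:
  assumes "simple_graph V E" and "e \<in> E" and "u \<in> e"
  obtains w where "e = {u, w}" "w \<noteq> u" "w \<in> V"
proof -
  have "card e = 2" "e \<subseteq> V" using assms unfolding simple_graph_def by auto
  then show thesis using assms(3) that by (auto simp: card_2_iff doubleton_eq_iff)
qed

text \<open>A new edge joins \<open>v\<close> to some \<open>u\<close> in \<open>P\<close>. All
  vertices in the fibre of \<open>u\<close> see \<open>v\<close> as well, so blocking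
  \<open>v\<close> with whole fibres reaches every new edge and no non-edge.\<close>

lemma edges_insert:
  assumes "simple_graph V E" and "v \<in> V" and "v \<notin> P"
  shows "{e \<in> E. e \<subseteq> insert v P} = {e \<in> E. e \<subseteq> P} \<union>
    (\<Union>Y\<in>{Y \<in> fibres (out_nbhd V E P) P. \<forall>u\<in>Y. {v, u} \<in> E}. pairs_between {v} Y)"
    (is "?l = ?r")
proof
  show "?l \<subseteq> ?r"
  proof
    fix e assume e: "e \<in> ?l"
    show "e \<in> ?r"
    proof (cases "v \<in> e")
      case True
      then obtain u where u: "e = {v, u}" "u \<noteq> v"
        using assms(1) e by (auto elim: simple_graph_edgeE)
      \<comment> \<open>The fibre of the other endpoint; its value is nonempty because it contains
        \<open>v\<close>.\<close>
      let ?Y = "{w \<in> P. out_nbhd V E P w = out_nbhd V E P u}"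
      have "u \<in> P" using e u by auto
      moreover have v: "v \<in> out_nbhd V E P u"
        using e u assms by (auto simp: out_nbhd_def neighbors_def insert_commute)
      ultimately have "?Y \<in> fibres (out_nbhd V E P) P" unfolding fibres_def by blast
      moreover have "{v, w} \<in> E" if "v \<in> out_nbhd V E P w" for w
        using that by (simp add: out_nbhd_def neighbors_def insert_commute)
      with v have "\<forall>w\<in>?Y. {v, w} \<in> E" by simp
      moreover have "e \<in> pairs_between {v} ?Y"
        using u \<open>u \<in> P\<close> unfolding pairs_between_def by blast
      ultimately show ?thesis by blast
    next
      case False
      then show ?thesis using e by blast
    qed
  qed
  show "?r \<subseteq> ?l" by (auto simp: fibres_def pairs_between_def)
qed

lemma reach_sweep_insert:
  assumes G: "simple_graph V E" and "P \<subseteq> V" and v: "v \<in> V" "v \<notin> P"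
    and k: "card (out_nbhd V E P ` P - {{}}) \<le> k"
  shows "reach V E (2 * k + 2) (sweep_config V E P) (sweep_config V E (insert v P))"
proof -
  let ?f = "out_nbhd V E P" and ?g = "out_nbhd V E (insert v P)"
  let ?L = "fibres ?f P"
  let ?B = "{Y \<in> ?L. \<forall>u\<in>Y. {v, u} \<in> E}"
  let ?c = "sweep_config V E P"
  \<comment> \<open>\<open>?d\<close> is the state after the birth of \<open>{v}\<close>, and
    \<open>?e\<close> the state after its blocks.\<close>
  let ?d = "\<lparr>born = insert v P, live = insert {v} ?L, placed = {e \<in> E. e \<subseteq> P}\<rparr>"
  let ?e = "\<lparr>born = insert v P, live = insert {v} ?L, placed = {e \<in> E. e \<subseteq> insert v P}\<rparr>"
  have finP: "finite P" using G \<open>P \<subseteq> V\<close> unfolding simple_graph_def by (blast intro: finite_subset)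
  then have finL: "finite ?L" by (simp add: fibres_def)
  \<comment> \<open>Fibres are indexed by the nonempty values of \<open>?f\<close>, so the bound on
    these values carries over.\<close>
  have cardL: "card ?L \<le> k"
    unfolding fibres_def using finP k by (intro order_trans[OF card_image_le]) auto
  have v_notin: "{v} \<notin> ?L" using v by (auto simp: fibres_def)
  have cardL': "2 * card (insert {v} ?L) \<le> 2 * k + 2" using finL cardL v_notin by simp
  have "cheap_step V E (2 * k + 2) ?c (apply_move ?c (Birth {v}))"
    using v cardL by (intro cheap_stepI) (auto simp: sweep_config_def)
  then have "cheap_step V E (2 * k + 2) ?c ?d" by (simp add: sweep_config_def)
  moreover have "reach V E (2 * k + 2) ?d
      (?d\<lparr>placed := placed ?d \<union> (\<Union>Y\<in>?B. pairs_between {v} Y)\<rparr>)"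
    by (rule reach_blocks) (use finL v_notin cardL' in \<open>auto simp: pairs_between_def\<close>)
  then have "reach V E (2 * k + 2) ?d ?e"
    using edges_insert[OF G v] by simp
  moreover have "reach V E (2 * k + 2) ?e (?e\<lparr>live := fibres ?g (insert v P)\<rparr>)"
  proof (rule reach_fibres)
    \<comment> \<open>Only \<open>v\<close> is lost from each value, so cables homogeneous for
      \<open>?f\<close> stay so for \<open>?g\<close>: they may merge or become exhausted but never
      need splitting.\<close>
    have g: "?g u = ?f u - {v}" for u by (auto simp: out_nbhd_def)
    show "finite (live ?e)" using finL by simp
    show "{} \<notin> live ?e" by (auto simp: fibres_def)
    show "\<Union>(live ?e) \<subseteq> insert v P" by (auto simp: fibres_def)
    show "u \<in> \<Union>(live ?e)" if u: "u \<in> insert v P" "?g u \<noteq> {}" for u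
    proof (cases "u = v")
      case False
      then have "u \<in> P" "?f u \<noteq> {}" using u g by auto
      then have "{w \<in> P. ?f w = ?f u} \<in> ?L" unfolding fibres_def by blast
      with \<open>u \<in> P\<close> show ?thesis by auto
    qed simp
    show "?g u = ?g w" if "X \<in> live ?e" "u \<in> X" "w \<in> X" for X u w
      using that by (auto simp: g fibres_def)
    \<comment> \<open>With \<open>?g u\<close> empty, every neighbour of \<open>u\<close> lies in
      \<open>insert v P\<close>, and \<open>?e\<close> has all edges inside that set placed.\<close>
    show "e \<in> placed ?e" if u: "u \<in> insert v P" "?g u = {}" and e: "e \<in> E" "u \<in> e" for u e
    proof -
      obtain w where w: "e = {u, w}" "w \<in> V" using simple_graph_edgeE[OF G e] by blast
      then have "w \<in> insert v P" using u(2) e(1) by (auto simp: out_nbhd_def neighbors_def)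
      with w u e show ?thesis by simp
    qed
    show "2 * card (live ?e) \<le> 2 * k + 2" using cardL' by simp
  qed
  then have "reach V E (2 * k + 2) ?e (sweep_config V E (insert v P))"
    by (simp add: sweep_config_def)
  ultimately show ?thesis by (meson converse_rtranclp_into_rtranclp rtranclp_trans)
qed

theorem proposition3p5:
  fixes V :: "'a set" and E :: "'a set set" and p :: "'a list" and k :: nat
  assumes "simple_graph V E"
    and "layout V p"
    and "anw V E p \<le> k"
  shows "\<exists>ms. is_play V E ms \<and> constructs V E ms \<and> play_width ms \<le> 2 * k + 2 \<and>
           (\<forall>S. Birth S \<in> set ms \<longrightarrow> (\<exists>v. S = {v}))"
proof -
  have p: "distinct p" "set p = V" using assms(2) by (auto simp: layout_def)
  \<comment> \<open>No edge is contained in the empty set, because edges have two elements.\<close>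
  have start: "sweep_config V E {} = init_config"
    using assms(1) by (auto simp: sweep_config_def init_config_def fibres_def simple_graph_def)
  have active: "card (out_nbhd V E (set (take i p)) ` set (take i p) - {{}}) \<le> k"
    if "i \<le> length p" for i
  proof -
    have "card (active_nbhds V E p i) \<le> anw V E p"
      unfolding anw_def using that by (intro Max_ge) auto
    then show ?thesis
      using assms(3) by (simp add: active_nbhds_def right_nbhd_def[abs_def] layout_prefix_def
          out_nbhd_def[abs_def])
  qed
  have "reach V E (2 * k + 2) init_config (sweep_config V E (set (take i p)))"
    if "i \<le> length p" for i
    using that
  proof (induction i)
    case 0
    show ?case by (simp add: start)
  next
    case (Suc i)
    have "p ! i \<notin> set (take i p)"
      using p(1) Suc.prems by (auto simp: in_set_conv_nth nth_eq_iff_index_eq)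
    moreover have "set (take (Suc i) p) = insert (p ! i) (set (take i p))"
      using Suc.prems by (simp add: take_Suc_conv_app_nth)
    moreover have "set (take i p) \<subseteq> V" "p ! i \<in> V"
      using Suc.prems p(2) by (auto dest: in_set_takeD)
    \<comment> \<open>The bound used is the one for the first \<open>i\<close> vertices, before
      \<open>p ! i\<close> is born.\<close>
    ultimately have "reach V E (2 * k + 2) (sweep_config V E (set (take i p)))
        (sweep_config V E (set (take (Suc i) p)))"
      using Suc.prems active[of i] reach_sweep_insert[OF assms(1)] by simp
    with Suc show ?case by (meson Suc_leD rtranclp_trans)
  qed
  from this[of "length p"] have "reach V E (2 * k + 2) init_config (sweep_config V E V)"
    by (simp add: p)
  then obtain ms where ms: "legal_from V E init_config ms" "width_from init_config ms \<le> 2 * k + 2"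
    "\<forall>S. Birth S \<in> set ms \<longrightarrow> (\<exists>v. S = {v})" "foldl apply_move init_config ms = sweep_config V E V"
    using reach_imp_moves by blast
  \<comment> \<open>With \<open>P = V\<close> all values of \<open>out_nbhd\<close> are empty, so no
    cable is live, and every edge lies inside \<open>V\<close>.\<close>
  have "constructs V E ms"
    using assms(1) by (auto simp: constructs_def final_config_def ms(4) sweep_config_def
        fibres_def out_nbhd_def simple_graph_def)
  with ms show ?thesis by (auto simp: is_play_def play_width_def)
qed

end
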